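(* Let $\mathbb{F}$ be a field of characteristic $p\ge 3$ and let $\mathcal{H}$ be the Heisenberg algebra with basis $x,y,z$ over $\mathbb F$. Up to isomorphism of restricted Lie algebras, there are three restricted Heisenberg algebras, which are pairwise non-isomorphic, respectively given by the linear forms $\theta=0$, $\theta=x^*$ and $\theta=z^*$.
   Context: $\mathcal{H}=\mathrm{Span}_{\mathbb F}\{x,y,z\}$ is the Lie algebra with $[x,y]=z$ and $z$ central. For a linear form $\theta:\mathcal{H}\to\mathbb F$, the restricted Heisenberg algebra $(\mathcal H,\theta)$ given by $\theta$ is $\mathcal H$ with the $p$-map determined by $x^{[p]}=\theta(x)z$, $y^{[p]}=\theta(y)z$, $z^{[p]}=\theta(z)z$, i.e. $(\alpha x+\beta y+\gamma z)^{[p]}=(\alpha^p\theta(x)+\beta^p\theta(y)+\gamma^p\theta(z))z$. A restricted Heisenberg algebra is $\mathcal H$ endowed with a $p$-map making it a restricted Lie algebra (every such $p$-map is of this form for some $\theta$). $x^*,y^*,z^*$ is the dual basis of $x,y,z$. An isomorphism of restricted Lie algebras is a Lie algebra isomorphism $\varphi$ with $\varphi(u^{[p]})=\varphi(u)^{[p]}$ for all $u$.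
   Formalization: That every restricted Heisenberg algebra is isomorphic to one of the three is claimed only when every element of F is both a p-th and a (p-1)-th power (e.g. F algebraically closed); it fails otherwise, e.g. for θ=2z* over F_p. *)

theory Defs
  imports "HOL-Analysis.Analysis"
begin

locale lie_algebra = vector_space scl
  for scl :: "'f::field \<Rightarrow> 'v::ab_group_add \<Rightarrow> 'v" +
  fixes bracket :: "'v \<Rightarrow> 'v \<Rightarrow> 'v"
  assumes linear_bracket_left: "Vector_Spaces.linear scl scl (\<lambda>u. bracket u v)"
    and linear_bracket_right: "Vector_Spaces.linear scl scl (bracket u)"
    and bracket_self: "bracket u u = 0"
    and jacobi: "bracket u (bracket v w) + bracket v (bracket w u) + bracket w (bracket u v) = 0"

text \<open>A polynomial of type \<^typ>\<open>'v poly\<close> stands for an element of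
  \<open>L[T] = L \<otimes> F[T]\<close>, the indeterminate acting as \<^term>\<open>pCons 0\<close>.
  The following operator is \<open>ad (T u + v)\<close> on \<open>L[T]\<close>.\<close>

definition ad_pencil ::
  "('v::ab_group_add \<Rightarrow> 'v \<Rightarrow> 'v) \<Rightarrow> 'v \<Rightarrow> 'v \<Rightarrow> 'v poly \<Rightarrow> 'v poly" where
  "ad_pencil bracket u v f = pCons 0 (map_poly (bracket u) f) + map_poly (bracket v) f"

text \<open>Jacobson's terms: \<open>i s\<^sub>i(u,v)\<close> is the coefficient of \<open>T^(i-1)\<close> in
  \<open>ad (T u + v)^(p-1) (u)\<close>, where \<open>p\<close> is the characteristic.\<close>

definition jacobson_term ::
  "('f::field \<Rightarrow> 'v::ab_group_add \<Rightarrow> 'v) \<Rightarrow> ('v \<Rightarrow> 'v \<Rightarrow> 'v) \<Rightarrow> nat \<Rightarrow> 'v \<Rightarrow> 'v \<Rightarrow> 'v" where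
  "jacobson_term scl bracket i u v =
     scl (inverse (of_nat i))
       (coeff ((ad_pencil bracket u v ^^ (CHAR('f) - 1)) [:u:]) (i - 1))"

locale restricted_lie_algebra = lie_algebra scl bracket
  for scl :: "'f::field \<Rightarrow> 'v::ab_group_add \<Rightarrow> 'v"
    and bracket :: "'v \<Rightarrow> 'v \<Rightarrow> 'v" +
  fixes pmap :: "'v \<Rightarrow> 'v"
  assumes char_pos: "CHAR('f) > 0"
    and pmap_scale: "pmap (scl a u) = scl (a ^ CHAR('f)) (pmap u)"
    and pmap_add: "pmap (u + v) =
          pmap u + pmap v + (\<Sum>i = 1..CHAR('f) - 1. jacobson_term scl bracket i u v)"
    and bracket_pmap: "bracket (pmap u) = bracket u ^^ CHAR('f)"

definition restricted_lie_iso ::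
  "('f::field \<Rightarrow> 'v::ab_group_add \<Rightarrow> 'v) \<Rightarrow> ('v \<Rightarrow> 'v \<Rightarrow> 'v) \<Rightarrow> ('v \<Rightarrow> 'v) \<Rightarrow>
   ('f \<Rightarrow> 'w::ab_group_add \<Rightarrow> 'w) \<Rightarrow> ('w \<Rightarrow> 'w \<Rightarrow> 'w) \<Rightarrow> ('w \<Rightarrow> 'w) \<Rightarrow> ('v \<Rightarrow> 'w) \<Rightarrow> bool" where
  "restricted_lie_iso s1 b1 p1 s2 b2 p2 \<phi> \<longleftrightarrow>
     Vector_Spaces.linear s1 s2 \<phi> \<and> bij \<phi> \<and>
     (\<forall>u v. \<phi> (b1 u v) = b2 (\<phi> u) (\<phi> v)) \<and>
     (\<forall>u. \<phi> (p1 u) = p2 (\<phi> u))"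

abbreviation heis_x :: "'f::field ^ 3" where "heis_x \<equiv> axis 1 1"
abbreviation heis_y :: "'f::field ^ 3" where "heis_y \<equiv> axis 2 1"
abbreviation heis_z :: "'f::field ^ 3" where "heis_z \<equiv> axis 3 1"

definition heis_bracket :: "'f::field ^ 3 \<Rightarrow> 'f ^ 3 \<Rightarrow> 'f ^ 3" where
  "heis_bracket u v = (u $ 1 * v $ 2 - u $ 2 * v $ 1) *s heis_z"

definition heis_pmap :: "('f::field ^ 3 \<Rightarrow> 'f) \<Rightarrow> 'f ^ 3 \<Rightarrow> 'f ^ 3" where
  "heis_pmap \<theta> u =
     ((u $ 1) ^ CHAR('f) * \<theta> heis_x + (u $ 2) ^ CHAR('f) * \<theta> heis_y
       + (u $ 3) ^ CHAR('f) * \<theta> heis_z) *s heis_z"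

definition restricted_heisenberg :: "('f::field ^ 3 \<Rightarrow> 'f ^ 3) \<Rightarrow> bool" where
  "restricted_heisenberg pmap \<longleftrightarrow> restricted_lie_algebra (*s) heis_bracket pmap"

definition heis_isomorphic :: "('f::field ^ 3 \<Rightarrow> 'f ^ 3) \<Rightarrow> ('f ^ 3 \<Rightarrow> 'f ^ 3) \<Rightarrow> bool" where
  "heis_isomorphic p1 p2 \<longleftrightarrow>
     (\<exists>\<phi>. restricted_lie_iso (*s) heis_bracket p1 (*s) heis_bracket p2 \<phi>)"

text \<open>The linear forms \<open>0\<close>, \<open>x\<^sup>*\<close> and \<open>z\<^sup>*\<close>.\<close>

definition theta_0 :: "'f::field ^ 3 \<Rightarrow> 'f" where "theta_0 = (\<lambda>u. 0)"
definition theta_x :: "'f::field ^ 3 \<Rightarrow> 'f" where "theta_x = (\<lambda>u. u $ 1)"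
definition theta_z :: "'f::field ^ 3 \<Rightarrow> 'f" where "theta_z = (\<lambda>u. u $ 3)"

text \<open>That every restricted Heisenberg algebra is isomorphic to one of these three
  needs roots in the ground field:
  if an isomorphism \<open>\<phi>\<close> from \<open>\<theta> = c z\<^sup>*\<close> to \<open>\<theta> = z\<^sup>*\<close> has \<open>\<phi>(z) = d z\<close>,
  then \<open>c = d^(p-1)\<close>; and \<open>\<theta> = a x\<^sup>* + z\<^sup>*\<close> is isomorphic to \<open>\<theta> = z\<^sup>*\<close> only if
  \<open>a\<close> is a \<open>p\<close>-th power. So the three algebras exhaust the isomorphism classes
  exactly when every scalar is both a \<open>p\<close>-th and a \<open>(p-1)\<close>-th power, which holds over
  algebraically closed fields but fails for instance over every prime field, where
  \<open>\<theta> = 2 z\<^sup>*\<close> is isomorphic to none of the three (\<open>p \<ge> 3\<close>).\<close>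

end

theory Submission
  imports Defs
begin

text \<open>Double brackets vanish in \<open>\<H>\<close>, so for \<open>p \<ge> 3\<close> Jacobson's terms vanish and a
  \<open>p\<close>-map is a \<open>p\<close>-semilinear map into the centre \<open>F z\<close>, i.e. it is given by a linear
  form. The three forms are separated by whether the \<open>p\<close>-map vanishes, and whether it vanishes
  on \<open>[\<H>,\<H>] = F z\<close>; conversely an automorphism of the Lie algebra \<open>\<H>\<close>
  with suitable \<open>p\<close>-th and \<open>(p-1)\<close>-th roots as matrix entries normalises any form.\<close>

section \<open>The Heisenberg Lie algebra in coordinates\<close>

lemma heis_bracket_nth [simp]:
  "heis_bracket u v $ 1 = 0" "heis_bracket u v $ 2 = 0"
  "heis_bracket u v $ 3 = u $ 1 * v $ 2 - u $ 2 * v $ 1"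
  by (auto simp: heis_bracket_def axis_def)

lemma heis_pmap_nth [simp]:
  fixes \<theta> :: "'f::field ^ 3 \<Rightarrow> 'f"
  shows "heis_pmap \<theta> u $ 1 = 0" "heis_pmap \<theta> u $ 2 = 0"
    "heis_pmap \<theta> u $ 3 = (u $ 1) ^ CHAR('f) * \<theta> heis_x + (u $ 2) ^ CHAR('f) * \<theta> heis_y
       + (u $ 3) ^ CHAR('f) * \<theta> heis_z"
  by (auto simp: heis_pmap_def axis_def)

lemma heis_basis_nth [simp]:
  "(heis_x :: 'f::field ^ 3) $ 1 = 1" "(heis_x :: 'f ^ 3) $ 2 = 0" "(heis_x :: 'f ^ 3) $ 3 = 0"
  "(heis_y :: 'f ^ 3) $ 1 = 0" "(heis_y :: 'f ^ 3) $ 2 = 1" "(heis_y :: 'f ^ 3) $ 3 = 0"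
  "(heis_z :: 'f ^ 3) $ 1 = 0" "(heis_z :: 'f ^ 3) $ 2 = 0" "(heis_z :: 'f ^ 3) $ 3 = 1"
  by (auto simp: axis_def)

lemma heis_bracket_heis_bracket: "heis_bracket u (heis_bracket v w) = 0"
  by (simp add: vec_eq_iff forall_3)

lemma lie_algebra_heis: "lie_algebra (*s) (heis_bracket :: 'f::field ^ 3 \<Rightarrow> _)"
proof (intro lie_algebra.intro lie_algebra_axioms.intro vec.vector_space_axioms)
  show "Vector_Spaces.linear (*s) (*s) (\<lambda>u. heis_bracket u v)" for v :: "'f ^ 3"
    by unfold_locales (auto simp: vec_eq_iff forall_3 algebra_simps)
  show "Vector_Spaces.linear (*s) (*s) (heis_bracket v)" for v :: "'f ^ 3"
    by unfold_locales (auto simp: vec_eq_iff forall_3 algebra_simps)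
qed (simp_all add: vec_eq_iff forall_3)

section \<open>The p-maps on the Heisenberg algebra\<close>

lemma heis_bracket_funpow_eq_0:
  assumes "n \<ge> 2"
  shows "(heis_bracket u ^^ n) v = 0"
proof -
  have "(heis_bracket u ^^ Suc (Suc m)) v = 0" for m
    by (simp add: heis_bracket_heis_bracket)
  then show ?thesis
    using assms by (auto simp: numeral_2_eq_2 le_iff_add)
qed

text \<open>Every coefficient of the result is a sum of double brackets; multiplication by the
  indeterminate merely shifts them to other degrees.\<close>

lemma heis_ad_pencil_ad_pencil:
  fixes u v :: "'f::field ^ 3"
  shows "ad_pencil heis_bracket u v (ad_pencil heis_bracket u v f) = 0"
proof -
  have z: "heis_bracket w 0 = 0" for w :: "'f ^ 3"
    by (simp add: vec_eq_iff forall_3)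
  have a: "heis_bracket w (s + t) = heis_bracket w s + heis_bracket w t" for w s t :: "'f ^ 3"
    by (simp add: vec_eq_iff forall_3 algebra_simps)
  show ?thesis
    by (rule poly_eqI)
      (auto simp: ad_pencil_def coeff_map_poly coeff_pCons z a heis_bracket_heis_bracket
        split: nat.splits)
qed

text \<open>For p \<ge> 3 the (p - 1)-fold iterate contains the square of the pencil. For p = 2 the
  term at i = 1 would be \<open>heis_bracket v u\<close>.\<close>

lemma heis_jacobson_term:
  fixes u v :: "'f::field ^ 3"
  assumes "CHAR('f) \<ge> 3"
  shows "jacobson_term (*s) heis_bracket i u v = 0"
proof -
  have "CHAR('f) - 1 = Suc (Suc (CHAR('f) - 3))"
    using assms by simp
  then show ?thesis
    by (simp add: jacobson_term_def heis_ad_pencil_ad_pencil)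
qed

text \<open>With Jacobson's terms gone, the sum rule is plain additivity. Since ad(u)^p = 0, the
  last axiom says that each \<open>P u\<close> is central, and the centre is F z.\<close>

lemma restricted_heisenberg_iff:
  fixes P :: "'f::field ^ 3 \<Rightarrow> 'f ^ 3"
  assumes "CHAR('f) \<ge> 3"
  shows "restricted_heisenberg P \<longleftrightarrow>
    (\<forall>a u. P (a *s u) = a ^ CHAR('f) *s P u) \<and> (\<forall>u v. P (u + v) = P u + P v) \<and>
    (\<forall>u. P u $ 1 = 0 \<and> P u $ 2 = 0)"
proof -
  have "heis_bracket u ^^ CHAR('f) = (\<lambda>_. 0)" for u :: "'f ^ 3"
    using assms by (intro ext heis_bracket_funpow_eq_0) simp
  moreover have "heis_bracket u = (\<lambda>_. 0) \<longleftrightarrow> u $ 1 = 0 \<and> u $ 2 = 0" for u :: "'f ^ 3"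
  proof
    assume "heis_bracket u = (\<lambda>_. 0)"
    \<comment> \<open>Bracketing with x and y reads off \<open>- u $ 2\<close> and
      \<open>u $ 1\<close>.\<close>
    then have "heis_bracket u heis_x $ 3 = 0" "heis_bracket u heis_y $ 3 = 0"
      by simp_all
    then show "u $ 1 = 0 \<and> u $ 2 = 0"
      by simp
  qed (auto simp: fun_eq_iff vec_eq_iff forall_3)
  ultimately show ?thesis
    using assms lie_algebra_heis[where 'f = 'f]
    by (simp add: restricted_heisenberg_def restricted_lie_algebra_def
        restricted_lie_algebra_axioms_def heis_jacobson_term)
qed

lemma restricted_heisenberg_heis_pmap:
  fixes \<theta> :: "'f::field ^ 3 \<Rightarrow> 'f"
  assumes "CHAR('f) \<ge> 3"
  shows "restricted_heisenberg (heis_pmap \<theta>)"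
proof -
  have "prime CHAR('f)"
    using assms by (intro prime_CHAR_semidom) auto
  then show ?thesis
    unfolding restricted_heisenberg_iff[OF assms]
    by (simp add: vec_eq_iff forall_3 freshmans_dream power_mult_distrib ring_distribs mult.assoc)
qed

lemma restricted_heisenberg_obtain_form:
  fixes P :: "'f::field ^ 3 \<Rightarrow> 'f ^ 3"
  assumes "CHAR('f) \<ge> 3" "restricted_heisenberg P"
  obtains \<theta> where "P = heis_pmap \<theta>"
proof
  note P = assms(2)[unfolded restricted_heisenberg_iff[OF assms(1)]]
  \<comment> \<open>This function is p-semilinear; \<open>heis_pmap\<close> evaluates it only at x,
    y and z, so it stands for the linear form with these values.\<close>
  let ?\<theta> = "\<lambda>u. P u $ 3"
  have "P u = heis_pmap ?\<theta> u" for u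
  proof -
    have "u = u $ 1 *s heis_x + u $ 2 *s heis_y + u $ 3 *s heis_z"
      by (simp add: vec_eq_iff forall_3)
    then have "P u = P (u $ 1 *s heis_x + u $ 2 *s heis_y + u $ 3 *s heis_z)"
      by (rule arg_cong)
    also have "\<dots> = (u $ 1) ^ CHAR('f) *s P heis_x + (u $ 2) ^ CHAR('f) *s P heis_y
        + (u $ 3) ^ CHAR('f) *s P heis_z"
      by (simp add: P)
    finally show ?thesis
      using P by (simp add: vec_eq_iff forall_3)
  qed
  then show "P = heis_pmap ?\<theta>" ..
qed

section \<open>Isomorphisms from matrices\<close>

text \<open>The matrix \<open>(\<alpha>, \<beta>, e; \<gamma>, \<delta>, f; 0, 0, d)\<close> lists the images of \<open>x\<close>, \<open>y\<close>, \<open>z\<close>; every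
  automorphism of the Lie algebra has this form.\<close>

lemma heis_isomorphic_heis_pmapI:
  fixes \<theta> \<theta>' :: "'f::field ^ 3 \<Rightarrow> 'f" and \<alpha> \<beta> \<gamma> \<delta> e f :: 'f
  defines "d \<equiv> \<alpha> * \<delta> - \<beta> * \<gamma>"
  assumes p: "CHAR('f) > 0" and d: "d \<noteq> 0"
    and x: "d * \<theta> heis_x = \<alpha> ^ CHAR('f) * \<theta>' heis_x + \<beta> ^ CHAR('f) * \<theta>' heis_y
      + e ^ CHAR('f) * \<theta>' heis_z"
    and y: "d * \<theta> heis_y = \<gamma> ^ CHAR('f) * \<theta>' heis_x + \<delta> ^ CHAR('f) * \<theta>' heis_y
      + f ^ CHAR('f) * \<theta>' heis_z"
    and z: "d * \<theta> heis_z = d ^ CHAR('f) * \<theta>' heis_z"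
  shows "heis_isomorphic (heis_pmap \<theta>) (heis_pmap \<theta>')"
proof -
  define \<phi> where "\<phi> u = (\<alpha> * u $ 1 + \<gamma> * u $ 2) *s heis_x + (\<beta> * u $ 1 + \<delta> * u $ 2) *s heis_y
    + (e * u $ 1 + f * u $ 2 + d * u $ 3) *s heis_z" for u :: "'f ^ 3"
  have \<phi>_nth [simp]: "\<phi> u $ 1 = \<alpha> * u $ 1 + \<gamma> * u $ 2" "\<phi> u $ 2 = \<beta> * u $ 1 + \<delta> * u $ 2"
    "\<phi> u $ 3 = e * u $ 1 + f * u $ 2 + d * u $ 3" for u
    by (simp_all add: \<phi>_def)
  have lin: "Vector_Spaces.linear (*s) (*s) \<phi>"
    by unfold_locales (auto simp: vec_eq_iff forall_3 algebra_simps)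
  have ker: "u = 0" if "\<phi> u = 0" for u
  proof -
    have 1: "\<alpha> * u $ 1 + \<gamma> * u $ 2 = 0" and 2: "\<beta> * u $ 1 + \<delta> * u $ 2 = 0"
      and 3: "e * u $ 1 + f * u $ 2 + d * u $ 3 = 0"
      by (simp_all add: that flip: \<phi>_nth)
    \<comment> \<open>Cramer's rule for the upper left 2 by 2 block, whose determinant is
      \<open>d\<close>.\<close>
    have "d * u $ 1 = \<delta> * (\<alpha> * u $ 1 + \<gamma> * u $ 2) - \<gamma> * (\<beta> * u $ 1 + \<delta> * u $ 2)"
      "d * u $ 2 = \<alpha> * (\<beta> * u $ 1 + \<delta> * u $ 2) - \<beta> * (\<alpha> * u $ 1 + \<gamma> * u $ 2)"
      by (simp_all add: d_def algebra_simps)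
    then have "d * u $ 1 = 0" "d * u $ 2 = 0"
      unfolding 1 2 by simp_all
    then have "u $ 1 = 0" "u $ 2 = 0"
      using d by simp_all
    then show ?thesis
      using d 3 by (simp add: vec_eq_iff forall_3)
  qed
  have "inj \<phi>"
    using lin ker by (simp add: vec.linear_inj_iff_eq_0)
  then have "bij \<phi>"
    using lin vec.linear_injective_imp_surjective by (auto simp: bij_def)
  moreover have "\<phi> (heis_bracket u v) = heis_bracket (\<phi> u) (\<phi> v)" for u v
    by (simp add: vec_eq_iff forall_3 d_def algebra_simps)
  moreover have "\<phi> (heis_pmap \<theta> u) = heis_pmap \<theta>' (\<phi> u)" for u
  proof -
    let ?p = "CHAR('f)"
    have fr: "(a + b) ^ ?p = a ^ ?p + b ^ ?p" for a b :: 'f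
      using p by (intro freshmans_dream prime_CHAR_semidom) auto
    \<comment> \<open>As \<phi> maps z to d z, the left side is the third coordinate of
      \<open>\<phi> (heis_pmap \<theta> u)\<close>. Both p-maps are p-semilinear, so the conditions
      \<open>x\<close>, \<open>y\<close>, \<open>z\<close> on the basis suffice.\<close>
    have "d * ((u $ 1) ^ ?p * \<theta> heis_x + (u $ 2) ^ ?p * \<theta> heis_y + (u $ 3) ^ ?p * \<theta> heis_z)
      = (u $ 1) ^ ?p * (d * \<theta> heis_x) + (u $ 2) ^ ?p * (d * \<theta> heis_y)
        + (u $ 3) ^ ?p * (d * \<theta> heis_z)"
      by (simp add: algebra_simps)
    also have "\<dots> = (\<alpha> * u $ 1 + \<gamma> * u $ 2) ^ ?p * \<theta>' heis_x
        + (\<beta> * u $ 1 + \<delta> * u $ 2) ^ ?p * \<theta>' heis_y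
        + (e * u $ 1 + f * u $ 2 + d * u $ 3) ^ ?p * \<theta>' heis_z"
      by (simp add: x y z fr power_mult_distrib algebra_simps)
    finally show ?thesis
      by (simp add: vec_eq_iff forall_3)
  qed
  ultimately show ?thesis
    using lin by (auto simp: heis_isomorphic_def restricted_lie_iso_def)
qed

section \<open>Separating and normalising the linear forms\<close>

lemma heis_isomorphic_theta_0_iff:
  fixes \<theta> :: "'f::field ^ 3 \<Rightarrow> 'f"
  assumes "CHAR('f) > 0"
  shows "heis_isomorphic (heis_pmap theta_0) (heis_pmap \<theta>) \<longleftrightarrow>
    \<theta> heis_x = 0 \<and> \<theta> heis_y = 0 \<and> \<theta> heis_z = 0"
proof
  assume "heis_isomorphic (heis_pmap theta_0) (heis_pmap \<theta>)"
  then obtain \<phi> where lin: "Vector_Spaces.linear (*s) (*s) \<phi>" and "bij \<phi>"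
    and \<phi>: "\<And>u. \<phi> (heis_pmap theta_0 u) = heis_pmap \<theta> (\<phi> u)"
    by (auto simp: heis_isomorphic_def restricted_lie_iso_def)
  have "heis_pmap theta_0 u = 0" for u :: "'f ^ 3"
    by (simp add: vec_eq_iff forall_3 theta_0_def)
  then have "heis_pmap \<theta> (\<phi> u) = 0" for u
    using vec.linear_0[OF lin] by (simp flip: \<phi>)
  then have "heis_pmap \<theta> v = 0" for v
    using surj_f_inv_f[OF bij_is_surj[OF \<open>bij \<phi>\<close>], of v] by metis
  then have "heis_pmap \<theta> heis_x $ 3 = 0" "heis_pmap \<theta> heis_y $ 3 = 0"
    "heis_pmap \<theta> heis_z $ 3 = 0"
    by simp_all
  then show "\<theta> heis_x = 0 \<and> \<theta> heis_y = 0 \<and> \<theta> heis_z = 0"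
    using assms by (simp add: power_0_left)
next
  assume "\<theta> heis_x = 0 \<and> \<theta> heis_y = 0 \<and> \<theta> heis_z = 0"
  then show "heis_isomorphic (heis_pmap theta_0) (heis_pmap \<theta>)"
    \<comment> \<open>The arguments come in the order \<alpha>, \<delta>, \<beta>, \<gamma>, so this
      is the identity map; both p-maps are zero.\<close>
    using assms heis_isomorphic_heis_pmapI[of 1 1 0 0 theta_0 \<theta> 0 0]
    by (simp add: theta_0_def)
qed

text \<open>Because z = [x,y] spans the derived algebra, \<phi> sends z to a nonzero multiple of z,
  so vanishing of the p-map on z is preserved. This separates \<open>theta_x\<close> from
  \<open>theta_z\<close>.\<close>

lemma heis_isomorphic_form_heis_z:
  fixes \<theta> \<theta>' :: "'f::field ^ 3 \<Rightarrow> 'f"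
  assumes p: "CHAR('f) > 0" and iso: "heis_isomorphic (heis_pmap \<theta>) (heis_pmap \<theta>')"
    and "\<theta> heis_z = 0"
  shows "\<theta>' heis_z = 0"
proof -
  obtain \<phi> where lin: "Vector_Spaces.linear (*s) (*s) \<phi>" and "bij \<phi>"
    and br: "\<And>u v. \<phi> (heis_bracket u v) = heis_bracket (\<phi> u) (\<phi> v)"
    and pm: "\<And>u. \<phi> (heis_pmap \<theta> u) = heis_pmap \<theta>' (\<phi> u)"
    using iso by (auto simp: heis_isomorphic_def restricted_lie_iso_def)
  have "heis_z = heis_bracket heis_x (heis_y :: 'f ^ 3)"
    by (simp add: vec_eq_iff forall_3)
  then have \<phi>z: "\<phi> heis_z = heis_bracket (\<phi> heis_x) (\<phi> heis_y)"
    using br by simp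
  have "\<phi> heis_z \<noteq> \<phi> 0"
    using \<open>bij \<phi>\<close> by (simp add: bij_is_inj inj_eq axis_eq_0_iff)
  then have "\<phi> heis_z \<noteq> 0"
    using lin by (simp add: vec.linear_0)
  then have "\<phi> heis_z $ 3 \<noteq> 0"
    using \<phi>z by (auto simp: vec_eq_iff forall_3)
  have "heis_pmap \<theta> heis_z = 0"
    using p assms(3) by (simp add: vec_eq_iff forall_3 power_0_left)
  then have "heis_pmap \<theta>' (\<phi> heis_z) $ 3 = 0"
    using pm[of heis_z] lin by (simp add: vec.linear_0)
  moreover have "\<phi> heis_z $ 1 = 0" "\<phi> heis_z $ 2 = 0"
    by (simp_all add: \<phi>z)
  ultimately show ?thesis
    using p \<open>\<phi> heis_z $ 3 \<noteq> 0\<close> by (simp add: power_0_left)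
qed

lemma heis_isomorphic_standard_form:
  fixes \<theta> :: "'f::field ^ 3 \<Rightarrow> 'f"
  assumes p: "CHAR('f) \<ge> 3"
    and root_p: "\<And>a::'f. \<exists>b. b ^ CHAR('f) = a"
    and root_p1: "\<And>a::'f. \<exists>b. b ^ (CHAR('f) - 1) = a"
  shows "\<exists>\<theta>' \<in> {theta_0, theta_x, theta_z}. heis_isomorphic (heis_pmap \<theta>) (heis_pmap \<theta>')"
proof (cases "\<theta> heis_z = 0")
  case True
  \<comment> \<open>Under \<open>theta_x\<close> the p-map sees only x-coordinates, so those of the
    images of x and y must be these p-th roots.\<close>
  obtain \<alpha> \<gamma> where \<alpha>: "\<alpha> ^ CHAR('f) = \<theta> heis_x" and \<gamma>: "\<gamma> ^ CHAR('f) = \<theta> heis_y"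
    using root_p by metis
  show ?thesis
  proof (cases "\<alpha> = 0 \<and> \<gamma> = 0")
    case True
    then have "\<theta> heis_x = 0" "\<theta> heis_y = 0"
      using \<alpha> \<gamma> p by (auto simp: power_0_left)
    then have "heis_isomorphic (heis_pmap \<theta>) (heis_pmap theta_0)"
      using p \<open>\<theta> heis_z = 0\<close> heis_isomorphic_heis_pmapI[of 1 1 0 0 \<theta> theta_0 0 0]
      by (simp add: theta_0_def)
    then show ?thesis by blast
  next
    case False
    \<comment> \<open>The nonzero column (\<alpha>, \<gamma>) is completed to determinant 1; below,
      \<open>that\<close> takes \<delta> before \<beta>.\<close>
    obtain \<beta> \<delta> where "\<alpha> * \<delta> - \<beta> * \<gamma> = 1"
    proof (cases "\<alpha> = 0")
      case True
      then show ?thesis using False that[of 0 "- 1 / \<gamma>"] by simp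
    next
      case False
      then show ?thesis using that[of "1 / \<alpha>" 0] by simp
    qed
    then have "heis_isomorphic (heis_pmap \<theta>) (heis_pmap theta_x)"
      using p \<open>\<theta> heis_z = 0\<close> \<alpha> \<gamma> heis_isomorphic_heis_pmapI[of \<alpha> \<delta> \<beta> \<gamma> \<theta> theta_x 0 0]
      by (simp add: theta_x_def)
    then show ?thesis by blast
  qed
next
  case False
  \<comment> \<open>If z is sent to d z, compatibility on z reads d \<theta>(z) = d^p, hence the (p
    - 1)-th root.\<close>
  obtain d where d: "d ^ (CHAR('f) - 1) = \<theta> heis_z"
    using root_p1 by metis
  have "d \<noteq> 0"
    using d False p by (auto simp: power_0_left)
  have dp: "d ^ CHAR('f) = d * \<theta> heis_z"
    using p by (simp flip: d power_Suc)
  \<comment> \<open>The z-components \<open>e\<close> and \<open>f\<close> of the images of x and y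
    absorb the values of \<theta> there; the block with diagonal d, 1 has the required
    determinant.\<close>
  obtain e f where "e ^ CHAR('f) = d * \<theta> heis_x" "f ^ CHAR('f) = d * \<theta> heis_y"
    using root_p by metis
  then have "heis_isomorphic (heis_pmap \<theta>) (heis_pmap theta_z)"
    using p \<open>d \<noteq> 0\<close> dp heis_isomorphic_heis_pmapI[of d 1 0 0 \<theta> theta_z e f]
    by (simp add: theta_z_def)
  then show ?thesis by blast
qed

text \<open>One direction per pair suffices, as inverses of restricted isomorphisms are again such.
  The roots assumed for exhaustiveness are those extracted in the normalisation.\<close>

theorem theorem4p3:
  fixes p :: nat
  assumes "CHAR('f::field) = p" and "p \<ge> 3"
  shows
    "(\<forall>\<theta> \<in> {theta_0, theta_x, theta_z :: 'f ^ 3 \<Rightarrow> 'f}. restricted_heisenberg (heis_pmap \<theta>))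
     \<and> \<not> heis_isomorphic (heis_pmap (theta_0 :: 'f ^ 3 \<Rightarrow> 'f)) (heis_pmap theta_x)
     \<and> \<not> heis_isomorphic (heis_pmap (theta_0 :: 'f ^ 3 \<Rightarrow> 'f)) (heis_pmap theta_z)
     \<and> \<not> heis_isomorphic (heis_pmap (theta_x :: 'f ^ 3 \<Rightarrow> 'f)) (heis_pmap theta_z)
     \<and> ((\<forall>a::'f. \<exists>b. b ^ p = a) \<and> (\<forall>a::'f. \<exists>b. b ^ (p - 1) = a) \<longrightarrow>
        (\<forall>pmap :: 'f ^ 3 \<Rightarrow> 'f ^ 3. restricted_heisenberg pmap \<longrightarrow>
           (\<exists>\<theta> \<in> {theta_0, theta_x, theta_z}. heis_isomorphic pmap (heis_pmap \<theta>))))"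
proof -
  have p: "CHAR('f) \<ge> 3" "CHAR('f) > 0"
    using assms by auto
  have "\<not> heis_isomorphic (heis_pmap (theta_x :: 'f ^ 3 \<Rightarrow> 'f)) (heis_pmap theta_z)"
    using heis_isomorphic_form_heis_z[OF p(2), of theta_x theta_z]
    by (auto simp: theta_x_def theta_z_def)
  moreover have "\<exists>\<theta> \<in> {theta_0, theta_x, theta_z}. heis_isomorphic P (heis_pmap \<theta>)"
    if roots: "\<forall>a::'f. \<exists>b. b ^ p = a" "\<forall>a::'f. \<exists>b. b ^ (p - 1) = a"
      and P: "restricted_heisenberg P"
    for P :: "'f ^ 3 \<Rightarrow> 'f ^ 3"
  proof -
    obtain \<theta> where "P = heis_pmap \<theta>"
      using restricted_heisenberg_obtain_form[OF p(1) P] .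
    then show ?thesis
      using heis_isomorphic_standard_form[OF p(1), of \<theta>] roots assms(1) by simp
  qed
  moreover have "\<not> heis_isomorphic (heis_pmap (theta_0 :: 'f ^ 3 \<Rightarrow> 'f)) (heis_pmap theta_x)"
    "\<not> heis_isomorphic (heis_pmap (theta_0 :: 'f ^ 3 \<Rightarrow> 'f)) (heis_pmap theta_z)"
    by (simp_all add: heis_isomorphic_theta_0_iff[OF p(2)] theta_x_def theta_z_def)
  ultimately show ?thesis
    using restricted_heisenberg_heis_pmap[OF p(1)] by blast
qed

end
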